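(* For every $L>0$ there exists a constant $C_L$ depending only on $L$ such that for all $p\in(0,1)$, all $Q>(6/L\lor12)$ and all integers $N\ge C_L\left(p^{-3}\lor(1-p)^{-3}\right)$ such that $T=pN$ is an integer, if $a_i=i/N$ and $y_i\sim\mathrm{Bernoulli}(m(a_i))$ for $i\in\{1,\dots,N\}$, then $$\inf_{\phi}\ \sup_{m\in\mathcal F_{p,L,Q}}\ \mathbb P\left(R_T^{\phi}(m)\ge0.01\,T^{1/3}p^{-1/3}\right)\ge0.1,$$ where the infimum is over all strategies $\phi$.
   Context: Finite continuum-armed bandit: there are $N$ arms with covariates $a_1,\dots,a_N\in[0,1]$ and a budget $T=pN$. Given a mean reward function $m:[0,1]\to[0,1]$, the rewards $y_1,\dots,y_N$ are independent with $\mathbb E[y_i]=m(a_i)$. A strategy $\phi$ chooses at each step $t=1,\dots,T$ an arm $\phi(t)\in\{1,\dots,N\}$ not pulled before, based on the past observations $(\phi(1),y_{\phi(1)},\dots,\phi(t-1),y_{\phi(t-1)})$ (and possibly independent randomization), without knowledge of $m$. Let $\phi^*$ be a permutation of $\{1,\dots,N\}$ with $m(a_{\phi^*(1)})\ge\dots\ge m(a_{\phi^*(N)})$. The regret is $R_T^\phi(m)=\sum_{t=1}^Tm(a_{\phi^*(t)})-\sum_{t=1}^Tm(a_{\phi(t)})$. With $\lambda$ the Lebesgue measure, for measurable $m$ and $p\in(0,1)$ let $M=\inf\{A:\lambda(\{x:m(x)\ge A\})<p\}$. $\mathcal F_{p,L,Q}$ is the set of measurable functions $m:[0,1]\to[0,1]$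 such that, for this $M$: (i) for all $(x,y)\in[0,1]^2$, $|m(x)-m(y)|\le\max\{|M-m(x)|,L|x-y|\}$; (ii) for all $\epsilon\in(0,1)$, $\lambda(\{x:|M-m(x)|\le\epsilon\})\le Q\epsilon$. $a\lor b=\max(a,b)$. *)

theory Defs
  imports "HOL-Probability.Probability" "HOL-Combinatorics.Permutations"
begin

section \<open>The class of mean reward functions\<close>

text \<open>
  A function on the unit interval is represented by a total function on the reals of which only the
  restriction to the unit interval matters.
\<close>

definition threshold :: "real \<Rightarrow> (real \<Rightarrow> real) \<Rightarrow> real" where
  "threshold p m = Inf {A. measure lborel {x \<in> {0..1}. m x \<ge> A} < p}"

definition reward_class :: "real \<Rightarrow> real \<Rightarrow> real \<Rightarrow> (real \<Rightarrow> real) set" where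
  "reward_class p L Q =
    {m. m \<in> borel_measurable (restrict_space borel {0..1}) \<and>
        m ` {0..1} \<subseteq> {0..1} \<and>
        (\<forall>x\<in>{0..1}. \<forall>y\<in>{0..1}.
           \<bar>m x - m y\<bar> \<le> max \<bar>threshold p m - m x\<bar> (L * \<bar>x - y\<bar>)) \<and>
        (\<forall>\<epsilon>\<in>{0<..<1}.
           measure lborel {x \<in> {0..1}. \<bar>threshold p m - m x\<bar> \<le> \<epsilon>} \<le> Q * \<epsilon>)}"

section \<open>Strategies and their interaction with the rewards\<close>

text \<open>
  A history lists the pulled arms with their observed rewards, oldest first. A reward is
  Bernoulli, with \<^const>\<open>True\<close> standing for 1 and \<^const>\<open>False\<close> for 0.
\<close>

type_synonym history = "(nat \<times> bool) list"

text \<open>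
  A strategy maps the past observations to the conditional distribution of the next arm; this
  accounts for independent randomization, and deterministic strategies are the point masses.
  Arms are numbered from 1 to \<open>N\<close> and are pulled at most once. For \<open>T \<le> N\<close> an unpulled arm is
  left after any history of length less than \<open>T\<close>.
\<close>

type_synonym strategy = "history \<Rightarrow> nat pmf"

definition strategies :: "nat \<Rightarrow> nat \<Rightarrow> strategy set" where
  "strategies N T =
    {\<phi>. \<forall>h. length h < T \<longrightarrow> set_pmf (\<phi> h) \<subseteq> {1..N} - fst ` set h}"

text \<open>The independent rewards \<open>y\<^sub>1, \<dots>, y\<^sub>N\<close>; \<^const>\<open>False\<close> is a dummy value outside \<open>{1..N}\<close>.\<close>

definition rewards_pmf :: "(nat \<Rightarrow> real) \<Rightarrow> (real \<Rightarrow> real) \<Rightarrow> nat \<Rightarrow> (nat \<Rightarrow> bool) pmf" where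
  "rewards_pmf a m N = Pi_pmf {1..N} False (\<lambda>i. bernoulli_pmf (m (a i)))"

primrec play :: "strategy \<Rightarrow> (nat \<Rightarrow> bool) \<Rightarrow> nat \<Rightarrow> history pmf" where
  "play \<phi> y 0 = return_pmf []"
| "play \<phi> y (Suc t) =
     bind_pmf (play \<phi> y t) (\<lambda>h. map_pmf (\<lambda>i. h @ [(i, y i)]) (\<phi> h))"

definition history_pmf ::
  "(nat \<Rightarrow> real) \<Rightarrow> (real \<Rightarrow> real) \<Rightarrow> nat \<Rightarrow> nat \<Rightarrow> strategy \<Rightarrow> history pmf" where
  "history_pmf a m N T \<phi> = bind_pmf (rewards_pmf a m N) (\<lambda>y. play \<phi> y T)"

section \<open>Regret\<close>

text \<open>
  Ties make the ordering permutation non-unique, but the regret does not depend on the choice.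
\<close>

definition best_perm :: "(nat \<Rightarrow> real) \<Rightarrow> (real \<Rightarrow> real) \<Rightarrow> nat \<Rightarrow> nat \<Rightarrow> nat" where
  "best_perm a m N = (SOME \<sigma>. \<sigma> permutes {1..N} \<and>
     (\<forall>i\<in>{1..N}. \<forall>j\<in>{1..N}. i \<le> j \<longrightarrow> m (a (\<sigma> i)) \<ge> m (a (\<sigma> j))))"

definition regret ::
  "(nat \<Rightarrow> real) \<Rightarrow> (real \<Rightarrow> real) \<Rightarrow> nat \<Rightarrow> nat \<Rightarrow> history \<Rightarrow> real" where
  "regret a m N T h =
     (\<Sum>t=1..T. m (a (best_perm a m N t))) - (\<Sum>t=1..T. m (a (fst (h ! (t - 1)))))"

end

theory Submission
  imports Defs
begin

text \<open>
  Two hypotheses in the style of Le Cam. Put \<open>K = min L (1/2)\<close> and let \<open>d\<close> be the distance to the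
  three nodes \<open>p - w\<close>, \<open>p\<close>, \<open>p + w\<close>. The mean reward is \<open>1/2 \<plusminus> K d\<close>, with signs
  \<open>+, s, -s, -\<close> on the four intervals cut out by the nodes and \<open>s = \<plusminus>1\<close>. Both functions have
  threshold \<open>1/2\<close>, have distance \<open>K d\<close> from it (the three nodes give the constant \<open>6 / K\<close>), and
  differ only on the two bumps of width \<open>w = 2 q / N\<close>. For every history the two regrets sum to
  at least \<open>2 K q\<^sup>2 / N\<close>. On the other hand all rewards may be drawn before the game, so any
  strategy distinguishes the hypotheses at most as well as the product Bernoulli laws do, and their
  squared Hellinger affinity is at least \<open>1 - 16 K\<^sup>2 q\<^sup>3 / N\<^sup>2\<close>. Taking \<open>q\<close> of order
  \<open>(N / K)\<^bsup>2/3\<^esup>\<close> keeps the affinity bounded below while the regret is of order \<open>N\<^bsup>1/3\<^esup>\<close>.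
\<close>

section \<open>Two-point testing bound\<close>

lemma measure_bind_pmf_finite:
  assumes "finite S" "set_pmf P \<subseteq> S"
  shows "measure (bind_pmf P K) E = (\<Sum>y\<in>S. pmf P y * measure (K y) E)"
proof -
  have "ennreal (measure (bind_pmf P K) E) = (\<integral>\<^sup>+y. ennreal (measure (K y) E) \<partial>P)"
    by (simp add: measure_pmf.emeasure_eq_measure[symmetric])
  also have "\<dots> = ennreal (measure_pmf.expectation P (\<lambda>y. measure (K y) E))"
    by (intro nn_integral_eq_integral measure_pmf.integrable_const_bound[where B=1]) auto
  also have "measure_pmf.expectation P (\<lambda>y. measure (K y) E) = (\<Sum>y\<in>S. measure (K y) E * pmf P y)"
    using assms by (intro integral_measure_pmf_real) auto
  finally show ?thesis
    by (simp add: sum_nonneg mult.commute)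
qed

text \<open>Le Cam's inequality: the product \<open>f y * g y\<close> is min times max, so
  Cauchy-Schwarz bounds the squared affinity by the sum of the minima times the sum of the maxima,
  and the latter is at most 2.\<close>

lemma sum_min_ge_half_affinity_square:
  fixes f g :: "'a \<Rightarrow> real"
  assumes nn: "\<And>y. y \<in> S \<Longrightarrow> 0 \<le> f y" "\<And>y. y \<in> S \<Longrightarrow> 0 \<le> g y"
    and "sum f S \<le> 1" "sum g S \<le> 1"
  shows "(\<Sum>y\<in>S. min (f y) (g y)) \<ge> (\<Sum>y\<in>S. sqrt (f y * g y))\<^sup>2 / 2"
proof -
  have eq: "sqrt (f y * g y) = sqrt (min (f y) (g y)) * sqrt (max (f y) (g y))" for y
    by (auto simp: real_sqrt_mult min_def max_def)
  have "(\<Sum>y\<in>S. sqrt (f y * g y))\<^sup>2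
      \<le> (\<Sum>y\<in>S. (sqrt (min (f y) (g y)))\<^sup>2) * (\<Sum>y\<in>S. (sqrt (max (f y) (g y)))\<^sup>2)"
    unfolding eq by (rule Cauchy_Schwarz_ineq_sum)
  also have "\<dots> = (\<Sum>y\<in>S. min (f y) (g y)) * (\<Sum>y\<in>S. max (f y) (g y))"
    using nn by (simp add: le_max_iff_disj)
  also have "\<dots> \<le> (\<Sum>y\<in>S. min (f y) (g y)) * 2"
  proof (rule mult_left_mono)
    have "(\<Sum>y\<in>S. max (f y) (g y)) \<le> (\<Sum>y\<in>S. f y + g y)"
      using nn by (intro sum_mono) (auto simp: max_def)
    then show "(\<Sum>y\<in>S. max (f y) (g y)) \<le> 2"
      using assms(3,4) by (simp add: sum.distrib)
  qed (use nn in \<open>auto intro!: sum_nonneg\<close>)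
  finally show ?thesis by simp
qed

text \<open>The kernel \<open>K\<close> is the same under both hypotheses. Since \<open>E\<close>
  and \<open>F\<close> cover its outcomes, their probabilities under \<open>K y\<close> add up to at
  least 1, so each \<open>y\<close> contributes at least the smaller of its two masses. In the
  application \<open>y\<close> is the reward vector and \<open>K y\<close> the play of the strategy
  against it.\<close>

lemma two_point_testing_bound:
  fixes P Q :: "'a pmf" and K :: "'a \<Rightarrow> 'b pmf"
  assumes fin: "finite S" and sub: "set_pmf P \<subseteq> S" "set_pmf Q \<subseteq> S"
    and supp: "\<And>y. y \<in> S \<Longrightarrow> set_pmf (K y) \<subseteq> E \<union> F"
  shows "measure (bind_pmf P K) E + measure (bind_pmf Q K) F
    \<ge> (\<Sum>y\<in>S. sqrt (pmf P y * pmf Q y))\<^sup>2 / 2"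
proof -
  have "(\<Sum>y\<in>S. sqrt (pmf P y * pmf Q y))\<^sup>2 / 2 \<le> (\<Sum>y\<in>S. min (pmf P y) (pmf Q y))"
    using fin sub by (intro sum_min_ge_half_affinity_square) (auto simp: sum_pmf_eq_1)
  also have "\<dots> \<le> (\<Sum>y\<in>S. pmf P y * measure (K y) E + pmf Q y * measure (K y) F)"
  proof (rule sum_mono)
    fix y assume "y \<in> S"
    have "1 = measure (K y) (E \<union> F)"
      using supp[OF \<open>y \<in> S\<close>] by (simp add: measure_pmf.prob_eq_1 AE_measure_pmf_iff subset_iff)
    also have "\<dots> \<le> measure (K y) E + measure (K y) F"
      by (rule measure_Un_le) auto
    finally have "min (pmf P y) (pmf Q y) * 1
        \<le> min (pmf P y) (pmf Q y) * (measure (K y) E + measure (K y) F)"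
      by (intro mult_left_mono) auto
    also have "\<dots> \<le> pmf P y * measure (K y) E + pmf Q y * measure (K y) F"
      unfolding distrib_left by (intro add_mono mult_right_mono) auto
    finally show "min (pmf P y) (pmf Q y)
        \<le> pmf P y * measure (K y) E + pmf Q y * measure (K y) F" by simp
  qed
  also have "\<dots> = measure (bind_pmf P K) E + measure (bind_pmf Q K) F"
    using fin sub by (simp add: measure_bind_pmf_finite sum.distrib)
  finally show ?thesis .
qed

section \<open>Affinity of product Bernoulli laws\<close>

lemma real_sqrt_prod_eq: "sqrt (\<Prod>i\<in>A. f i) = (\<Prod>i\<in>A. sqrt (f i))"
  by (induction A rule: infinite_finite_induct) (auto simp: real_sqrt_mult)

text \<open>Transports \<open>prod_sum_PiE\<close> to functions with default value \<open>d\<close>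
  off \<open>A\<close>, the form taken by the outcomes of \<open>Pi_pmf\<close>.\<close>

lemma sum_PiE_dflt_prod:
  fixes f :: "'a \<Rightarrow> 'b \<Rightarrow> real"
  assumes "finite A" "\<And>x. x \<in> A \<Longrightarrow> finite (B x)"
  shows "(\<Sum>g\<in>PiE_dflt A d B. \<Prod>x\<in>A. f x (g x)) = (\<Prod>x\<in>A. \<Sum>y\<in>B x. f x y)"
proof -
  let ?e = "\<lambda>h x. if x \<in> A then h x else d"
  have inj: "inj_on ?e (PiE A B)"
  proof (rule inj_onI)
    fix g h assume gh: "g \<in> PiE A B" "h \<in> PiE A B" "?e g = ?e h"
    show "g = h"
    proof (rule PiE_ext[OF gh(1,2)])
      fix x assume "x \<in> A"
      then show "g x = h x" using fun_cong[OF gh(3), of x] by simp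
    qed
  qed
  have "(\<Sum>g\<in>PiE_dflt A d B. \<Prod>x\<in>A. f x (g x))
      = (\<Sum>g\<in>PiE A B. \<Prod>x\<in>A. f x (?e g x))"
    by (subst dflt_image_PiE[symmetric], subst sum.reindex[OF inj]) simp
  also have "\<dots> = (\<Sum>g\<in>PiE A B. \<Prod>x\<in>A. f x (g x))"
    by (intro sum.cong prod.cong) auto
  also have "\<dots> = (\<Prod>x\<in>A. \<Sum>y\<in>B x. f x y)"
    by (rule prod_sum_PiE[symmetric]) (use assms in auto)
  finally show ?thesis .
qed

lemma affinity_Pi_pmf:
  fixes P Q :: "'a \<Rightarrow> bool pmf"
  assumes "finite A"
  shows "(\<Sum>y\<in>PiE_dflt A d (\<lambda>_. UNIV). sqrt (pmf (Pi_pmf A d P) y * pmf (Pi_pmf A d Q) y))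
    = (\<Prod>i\<in>A. \<Sum>b\<in>UNIV. sqrt (pmf (P i) b * pmf (Q i) b))"
proof -
  have "(\<Sum>y\<in>PiE_dflt A d (\<lambda>_. UNIV). sqrt (pmf (Pi_pmf A d P) y * pmf (Pi_pmf A d Q) y))
      = (\<Sum>y\<in>PiE_dflt A d (\<lambda>_. UNIV). \<Prod>i\<in>A. sqrt (pmf (P i) (y i) * pmf (Q i) (y i)))"
  proof (rule sum.cong[OF refl])
    fix y :: "'a \<Rightarrow> bool" assume "y \<in> PiE_dflt A d (\<lambda>_. UNIV)"
    then have "x \<notin> A \<Longrightarrow> y x = d" for x by (simp add: PiE_dflt_def)
    then show "sqrt (pmf (Pi_pmf A d P) y * pmf (Pi_pmf A d Q) y)
        = (\<Prod>i\<in>A. sqrt (pmf (P i) (y i) * pmf (Q i) (y i)))"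
      using assms by (simp add: pmf_Pi' prod.distrib real_sqrt_mult real_sqrt_prod_eq)
  qed
  also have "\<dots> = (\<Prod>i\<in>A. \<Sum>b\<in>UNIV. sqrt (pmf (P i) b * pmf (Q i) b))"
    by (rule sum_PiE_dflt_prod) (use assms in auto)
  finally show ?thesis .
qed

text \<open>A coordinate with equal laws has affinity 1. Success probabilities \<open>u\<close> and
  \<open>1 - u\<close> have affinity \<open>2 * sqrt (u * (1 - u))\<close>, whose square is exactly
  \<open>1 - 4 * (u - 1/2)^2\<close>. The Weierstrass inequality turns the product of these squares
  into a linear bound.\<close>

lemma affinity_bernoulli_ge:
  fixes u v :: "nat \<Rightarrow> real"
  assumes fin: "finite A" and BA: "B \<subseteq> A"
    and range: "\<And>i. i \<in> A \<Longrightarrow> u i \<in> {0..1}"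
    and same: "\<And>i. i \<in> A - B \<Longrightarrow> v i = u i"
    and opposite: "\<And>i. i \<in> B \<Longrightarrow> v i = 1 - u i"
    and close: "\<And>i. i \<in> B \<Longrightarrow> \<bar>u i - 1/2\<bar> \<le> \<delta>"
  shows "(\<Prod>i\<in>A. \<Sum>b\<in>UNIV. sqrt (pmf (bernoulli_pmf (u i)) b * pmf (bernoulli_pmf (v i)) b))\<^sup>2
    \<ge> 1 - 4 * real (card B) * \<delta>\<^sup>2"
proof -
  let ?c = "\<lambda>i. \<Sum>b\<in>UNIV. sqrt (pmf (bernoulli_pmf (u i)) b * pmf (bernoulli_pmf (v i)) b)"
  have c_same: "?c i = 1" if "i \<in> A - B" for i
    using range[of i] same[of i] that by (simp add: UNIV_bool)
  have c_opp: "(?c i)\<^sup>2 = 1 - 4 * (u i - 1/2)\<^sup>2" if "i \<in> B" for i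
  proof -
    have r: "0 \<le> u i" "u i \<le> 1" using range[of i] that BA by auto
    then have "?c i = 2 * sqrt (u i * (1 - u i))"
      using opposite[OF that] by (simp add: UNIV_bool mult.commute)
    then have "(?c i)\<^sup>2 = 4 * (u i * (1 - u i))"
      using r by (simp add: power_mult_distrib)
    then show ?thesis by (simp add: power2_eq_square algebra_simps)
  qed
  have "1 - 4 * real (card B) * \<delta>\<^sup>2 = 1 - (\<Sum>i\<in>B. 4 * \<delta>\<^sup>2)"
    by simp
  also have "\<dots> \<le> 1 - (\<Sum>i\<in>B. 4 * (u i - 1/2)\<^sup>2)"
    using close by (intro diff_left_mono sum_mono mult_left_mono)
      (auto simp: abs_le_square_iff[symmetric] intro: order_trans[OF _ abs_ge_self])
  also have "\<dots> \<le> (\<Prod>i\<in>B. 1 - 4 * (u i - 1/2)\<^sup>2)"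
  proof (rule Weierstrass_prod_ineq)
    fix i assume "i \<in> B"
    \<comment> \<open>The upper bound 1 on the defect is read off from the squared affinity being
      nonnegative.\<close>
    moreover have "0 \<le> (?c i)\<^sup>2" by (rule zero_le_power2)
    ultimately show "4 * (u i - 1/2)\<^sup>2 \<in> {0..1}"
      using c_opp[of i] by simp
  qed
  also have "\<dots> = (\<Prod>i\<in>B. (?c i)\<^sup>2)"
    using c_opp by simp
  also have "\<dots> = (\<Prod>i\<in>A. (?c i)\<^sup>2)"
    using c_same by (intro prod.mono_neutral_left fin BA) auto
  finally show ?thesis by (simp add: prod_power_distrib)
qed

section \<open>The two mean reward functions\<close>

definition node_dist :: "real \<Rightarrow> real \<Rightarrow> real \<Rightarrow> real" where
  "node_dist p w x = min \<bar>x - (p - w)\<bar> (min \<bar>x - p\<bar> \<bar>x - (p + w)\<bar>)"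

text \<open>The jumps at the nodes do no harm: \<open>bump_mean\<close> multiplies the sign by
  \<open>node_dist\<close>, which vanishes there.\<close>

definition bump_sign :: "real \<Rightarrow> real \<Rightarrow> real \<Rightarrow> real \<Rightarrow> real" where
  "bump_sign s p w x = (if x < p - w then 1 else if x < p then s else if x < p + w then - s else -1)"

definition bump_mean :: "real \<Rightarrow> real \<Rightarrow> real \<Rightarrow> real \<Rightarrow> real \<Rightarrow> real" where
  "bump_mean K s p w x = 1/2 + K * (bump_sign s p w x * node_dist p w x)"

lemma node_dist_nonneg: "0 \<le> node_dist p w x"
  by (simp add: node_dist_def)

lemma node_dist_lipschitz: "\<bar>node_dist p w x - node_dist p w y\<bar> \<le> \<bar>x - y\<bar>"
proof -
  have "\<bar>min u v - min u' v'\<bar> \<le> max \<bar>u - u'\<bar> \<bar>v - v'\<bar>" for u v u' v' :: real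
    by linarith
  note min_lipschitz = this
  have abs_lipschitz: "\<bar>\<bar>x - z\<bar> - \<bar>y - z\<bar>\<bar> \<le> \<bar>x - y\<bar>" for z
    by linarith
  show ?thesis
    unfolding node_dist_def
    by (intro order_trans[OF min_lipschitz] max.boundedI abs_lipschitz)
qed

lemma abs_bump_sign: "\<bar>s\<bar> = 1 \<Longrightarrow> \<bar>bump_sign s p w x\<bar> = 1"
  by (simp add: bump_sign_def)

lemma bump_mean_dist:
  assumes "\<bar>s\<bar> = 1" "0 \<le> K"
  shows "\<bar>1/2 - bump_mean K s p w x\<bar> = K * node_dist p w x"
  using assms by (simp add: bump_mean_def abs_mult abs_bump_sign node_dist_nonneg)

lemma signed_node_dist_lipschitz:
  assumes s: "\<bar>s\<bar> = 1" and w: "0 \<le> w"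
  shows "\<bar>bump_sign s p w x * node_dist p w x - bump_sign s p w y * node_dist p w y\<bar> \<le> \<bar>x - y\<bar>"
proof (cases "bump_sign s p w x = bump_sign s p w y")
  case True
  then have "\<bar>bump_sign s p w x * node_dist p w x - bump_sign s p w y * node_dist p w y\<bar>
      = \<bar>bump_sign s p w y * (node_dist p w x - node_dist p w y)\<bar>"
    by (simp add: right_diff_distrib)
  also have "\<dots> \<le> \<bar>x - y\<bar>"
    using node_dist_lipschitz by (simp add: abs_mult abs_bump_sign[OF s])
  finally show ?thesis .
next
  case False
  \<comment> \<open>Then a zero of the signed distance separates the two points.\<close>
  have "node_dist p w x + node_dist p w y \<le> \<bar>x - y\<bar>"
  proof -
    have near: "node_dist p w u \<le> \<bar>u - z\<bar>" if "z \<in> {p - w, p, p + w}" for u z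
      using that by (auto simp: node_dist_def)
    obtain z where "z \<in> {p - w, p, p + w}" "min x y \<le> z" "z \<le> max x y"
      using False w unfolding bump_sign_def by (fastforce split: if_splits)
    with near[of z x] near[of z y] show ?thesis by linarith
  qed
  moreover have "\<bar>bump_sign s p w x * node_dist p w x - bump_sign s p w y * node_dist p w y\<bar>
      \<le> \<bar>bump_sign s p w x * node_dist p w x\<bar> + \<bar>bump_sign s p w y * node_dist p w y\<bar>"
    by (rule abs_triangle_ineq4)
  ultimately show ?thesis
    by (simp add: abs_mult abs_bump_sign[OF s] node_dist_nonneg)
qed

lemma bump_mean_lipschitz:
  assumes "\<bar>s\<bar> = 1" "0 \<le> w" "0 \<le> K"
  shows "\<bar>bump_mean K s p w x - bump_mean K s p w y\<bar> \<le> K * \<bar>x - y\<bar>"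
proof -
  have "\<bar>bump_mean K s p w x - bump_mean K s p w y\<bar>
     = K * \<bar>bump_sign s p w x * node_dist p w x - bump_sign s p w y * node_dist p w y\<bar>"
    using assms by (simp add: bump_mean_def right_diff_distrib[symmetric] abs_mult)
  then show ?thesis
    using signed_node_dist_lipschitz assms by (simp add: mult_left_mono)
qed

lemma bump_mean_measurable [measurable]: "bump_mean K s p w \<in> borel_measurable borel"
  unfolding bump_mean_def bump_sign_def node_dist_def by measurable

text \<open>The levels whose superlevel set has measure below \<open>p\<close> are exactly those
  above 1/2. Exchanging the signs of two bumps of equal width leaves the measure of the positive
  region equal to \<open>p\<close>, so both hypotheses share the threshold.\<close>

lemma threshold_bump_mean:
  assumes s: "\<bar>s\<bar> = 1" and K: "0 < K" and w: "0 < w" "w \<le> p" "p + w \<le> 1"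
  shows "threshold p (bump_mean K s p w) = 1/2"
proof -
  let ?V = "\<lambda>A. {x \<in> {0..1}. bump_mean K s p w x \<ge> A}"
  have s': "s = 1 \<or> s = -1" using s by linarith
  have fin: "?V A \<in> fmeasurable lborel" for A
    by (rule fmeasurableI2[of "{0..1}"]) (auto intro: fmeasurable_compact)
  have eq: "measure lborel (?V A) < p \<longleftrightarrow> 1/2 < A" for A
  proof
    assume lt: "measure lborel (?V A) < p"
    show "1/2 < A"
    proof (rule ccontr)
      assume A: "\<not> 1/2 < A"
      \<comment> \<open>This is the region of positive sign. For \<open>s = -1\<close> its second
        piece is the bump to the right of \<open>p\<close>.\<close>
      define W where "W = (if s = 1 then {0..<p} else {0..<p-w} \<union> {p..<p+w})"
      have "measure lborel W = p"
      proof (cases "s = 1")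
        case False
        have "measure lborel ({0..<p-w} \<union> {p..<p+w})
            = measure lborel {0..<p-w} + measure lborel {p..<p+w}"
          by (rule measure_Union) (use w in auto)
        with False have "measure lborel W = measure lborel {0..<p-w} + measure lborel {p..<p+w}"
          by (simp add: W_def)
        then show ?thesis using w by simp
      qed (use w in \<open>simp add: W_def\<close>)
      moreover have "W \<subseteq> ?V A"
      proof
        fix x assume x: "x \<in> W"
        then have "bump_sign s p w x = 1" and "x \<in> {0..1}"
          using s' w by (auto simp: W_def bump_sign_def split: if_splits)
        moreover then have "bump_mean K s p w x \<ge> 1/2"
          using K node_dist_nonneg[of p w x] by (simp add: bump_mean_def)
        ultimately show "x \<in> ?V A" using A by simp
      qed
      then have "measure lborel W \<le> measure lborel (?V A)"
        by (intro measure_mono_fmeasurable fin) (auto simp: W_def)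
      ultimately show False using lt by simp
    qed
  next
    assume A: "1/2 < A"
    \<comment> \<open>The mean leaves a node with slope \<open>K\<close>, so it reaches
      \<open>A\<close> only at distance \<open>(A - 1/2) / K\<close> from all nodes. The cap
      \<open>w\<close> keeps the intervals in the next definition from having negative length; they
      lose \<epsilon> of the total length \<open>p\<close>.\<close>
    define \<epsilon> where "\<epsilon> = min w ((A - 1/2) / K)"
    have \<epsilon>: "0 < \<epsilon>" "\<epsilon> \<le> w" using A K w by (auto simp: \<epsilon>_def)
    define W where "W = (if s = 1 then {0..p-\<epsilon>} else {0..p-w} \<union> {p+\<epsilon>..p+w})"
    have sub: "?V A \<subseteq> W"
    proof
      fix x assume "x \<in> ?V A"
      then have x: "0 \<le> x" "x \<le> 1" and "A - 1/2 \<le> K * (bump_sign s p w x * node_dist p w x)"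
        by (auto simp: bump_mean_def)
      then have "(A - 1/2) / K \<le> bump_sign s p w x * node_dist p w x"
        using K by (simp add: field_simps)
      then have "\<epsilon> \<le> bump_sign s p w x * node_dist p w x"
        by (simp add: \<epsilon>_def)
      with \<epsilon> x w s' show "x \<in> W"
        by (auto simp: W_def bump_sign_def node_dist_def split: if_splits)
    qed
    have "measure lborel (?V A) \<le> measure lborel W"
      by (intro measure_mono_fmeasurable sub)
        (auto simp: W_def intro!: fmeasurable.Un fmeasurable_compact)
    also have "measure lborel W < p"
    proof (cases "s = 1")
      case False
      have "measure lborel ({0..p-w} \<union> {p+\<epsilon>..p+w})
          \<le> measure lborel {0..p-w} + measure lborel {p+\<epsilon>..p+w}"
        by (rule measure_Un_le) auto
      with False have "measure lborel W \<le> measure lborel {0..p-w} + measure lborel {p+\<epsilon>..p+w}"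
        by (simp add: W_def)
      then show ?thesis using w \<epsilon> by simp
    qed (use w \<epsilon> in \<open>simp add: W_def\<close>)
    finally show "measure lborel (?V A) < p" .
  qed
  have "Inf {1/2<..} = (1/2 :: real)"
    by simp
  then show ?thesis
    by (simp only: threshold_def eq greaterThan_def)
qed

text \<open>Three intervals of radius \<eta>, one around each node, cover the set.\<close>

lemma measure_node_dist_le:
  assumes "0 \<le> \<eta>"
  shows "measure lborel {x \<in> {0..1}. node_dist p w x \<le> \<eta>} \<le> 6 * \<eta>"
proof -
  let ?I = "\<lambda>z. {z - \<eta>..z + \<eta>}"
  have "measure lborel {x \<in> {0..1}. node_dist p w x \<le> \<eta>}
      \<le> measure lborel (?I (p - w) \<union> (?I p \<union> ?I (p + w)))"
  proof (rule measure_mono_fmeasurable)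
    show "?I (p - w) \<union> (?I p \<union> ?I (p + w)) \<in> fmeasurable lborel"
      by (intro fmeasurable.Un fmeasurable_compact compact_Icc)
    show "{x \<in> {0..1}. node_dist p w x \<le> \<eta>} \<in> sets lborel"
      unfolding node_dist_def by measurable
  qed (auto simp: node_dist_def min_le_iff_disj abs_le_iff)
  also have "\<dots> \<le> measure lborel (?I (p - w)) + measure lborel (?I p \<union> ?I (p + w))"
    by (rule measure_Un_le) auto
  also have "\<dots> \<le> measure lborel (?I (p - w)) + (measure lborel (?I p) + measure lborel (?I (p + w)))"
    by (intro add_left_mono measure_Un_le) auto
  also have "\<dots> = 6 * \<eta>" using assms by simp
  finally show ?thesis .
qed

text \<open>A point of the unit interval is within distance 1 of the node \<open>p\<close>, so a
  slope of at most 1/2 keeps the mean within 1/2 of its centre.\<close>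

lemma bump_mean_range:
  assumes "\<bar>s\<bar> = 1" "0 < K" "K \<le> 1/2" "0 \<le> p" "p \<le> 1" "x \<in> {0..1}"
  shows "bump_mean K s p w x \<in> {0..1}"
proof -
  have "K * node_dist p w x \<le> 1/2 * 1"
    using assms by (intro mult_mono) (auto simp: node_dist_def min_le_iff_disj)
  then have "\<bar>1/2 - bump_mean K s p w x\<bar> \<le> 1/2"
    using bump_mean_dist assms by simp
  then show ?thesis unfolding atLeastAtMost_iff by linarith
qed

text \<open>Condition (i) holds through its Lipschitz alternative, as \<open>K\<close> is at most
  \<open>L\<close>. In condition (ii), closeness \<epsilon> to the threshold means distance at most
  \<open>\<epsilon> / K\<close> to the nodes.\<close>

lemma bump_mean_in_reward_class:
  assumes s: "\<bar>s\<bar> = 1" and K: "0 < K" "K \<le> L" "K \<le> 1/2"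
    and w: "0 < w" "w \<le> p" "p + w \<le> 1" and Q: "6 / K \<le> Q"
  shows "bump_mean K s p w \<in> reward_class p L Q"
proof -
  have "\<bar>bump_mean K s p w x - bump_mean K s p w y\<bar> \<le> L * \<bar>x - y\<bar>" for x y
    using bump_mean_lipschitz[of s w K p x y] assms
      mult_right_mono[of K L "\<bar>x - y\<bar>"] by auto
  moreover have "measure lborel {x \<in> {0..1}. \<bar>1/2 - bump_mean K s p w x\<bar> \<le> \<epsilon>} \<le> Q * \<epsilon>"
    if "0 < \<epsilon>" for \<epsilon>
  proof -
    have "measure lborel {x \<in> {0..1}. \<bar>1/2 - bump_mean K s p w x\<bar> \<le> \<epsilon>}
        = measure lborel {x \<in> {0..1}. node_dist p w x \<le> \<epsilon> / K}"
      using s K by (simp add: bump_mean_dist pos_le_divide_eq mult.commute)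
    also have "\<dots> \<le> 6 * (\<epsilon> / K)"
      using that K by (intro measure_node_dist_le) simp
    also have "\<dots> \<le> Q * \<epsilon>"
      using Q that mult_right_mono[of "6 / K" Q \<epsilon>] by simp
    finally show ?thesis .
  qed
  moreover have "bump_mean K s p w ` {0..1} \<subseteq> {0..1}"
    using bump_mean_range assms by auto
  moreover have "bump_mean K s p w \<in> borel_measurable (restrict_space borel {0..1})"
    by (intro measurable_restrict_space1) measurable
  ultimately show ?thesis
    by (auto simp: reward_class_def threshold_bump_mean[OF s K(1) w] intro: max.coboundedI2)
qed

section \<open>Regret\<close>

text \<open>Ensures that the \<open>SOME\<close> in \<open>best_perm\<close> picks a genuine sorting
  permutation. The witness reads the arms off a list in descending order.\<close>

lemma sorting_perm_exists:
  fixes f :: "nat \<Rightarrow> 'a :: linorder"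
  shows "\<exists>\<sigma>. \<sigma> permutes {1..N} \<and> (\<forall>i\<in>{1..N}. \<forall>j\<in>{1..N}. i \<le> j \<longrightarrow> f (\<sigma> i) \<ge> f (\<sigma> j))"
proof -
  define xs where "xs = rev (sort_key f [1..<Suc N])"
  have len: "length xs = N" and set: "set xs = {1..N}" and dist: "distinct xs"
    by (auto simp: xs_def)
  have sorted: "f (xs ! i) \<ge> f (xs ! j)" if "i \<le> j" "j < N" for i j
  proof -
    have "sorted (rev (map f xs))"
      by (simp add: xs_def rev_map[symmetric])
    then show ?thesis
      using sorted_rev_nth_mono[of "map f xs" i j] that len by simp
  qed
  \<comment> \<open>List positions start at 0 and ranks at 1, hence the shift.\<close>
  define \<sigma> where "\<sigma> i = (if i \<in> {1..N} then xs ! (i - 1) else i)" for i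
  have "bij_betw (\<lambda>i. i - 1) {1..N} {..<N}"
    by (rule bij_betwI[where g=Suc]) auto
  moreover have "bij_betw ((!) xs) {..<N} {1..N}"
    by (rule bij_betw_nth) (use len set dist in auto)
  ultimately have "bij_betw ((!) xs \<circ> (\<lambda>i. i - 1)) {1..N} {1..N}"
    by (rule bij_betw_trans)
  also have "?this \<longleftrightarrow> bij_betw \<sigma> {1..N} {1..N}"
    by (rule bij_betw_cong) (simp add: \<sigma>_def)
  finally have "\<sigma> permutes {1..N}"
    by (rule bij_imp_permutes) (auto simp: \<sigma>_def)
  moreover have "\<forall>i\<in>{1..N}. \<forall>j\<in>{1..N}. i \<le> j \<longrightarrow> f (\<sigma> i) \<ge> f (\<sigma> j)"
    using sorted by (auto simp: \<sigma>_def)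
  ultimately show ?thesis by blast
qed

text \<open>Exchange argument: the value \<open>c\<close> of rank \<open>T\<close> separates the top
  set \<open>B\<close> from the other arms, and \<open>S - B\<close> has as many elements as
  \<open>B - S\<close>.\<close>

lemma sum_best_perm_ge:
  assumes S: "S \<subseteq> {1..N}" "card S = T"
  shows "(\<Sum>t=1..T. m (a (best_perm a m N t))) \<ge> (\<Sum>i\<in>S. m (a i))"
proof (cases "T = 0")
  case True
  then show ?thesis using S finite_subset[OF S(1)] by auto
next
  case False
  let ?\<sigma> = "best_perm a m N" and ?f = "\<lambda>i. m (a i)"
  have TN: "T \<le> N" using card_mono[OF _ S(1)] S(2) by simp
  have perm: "?\<sigma> permutes {1..N}"
    and sorted: "\<And>i j. i \<in> {1..N} \<Longrightarrow> j \<in> {1..N} \<Longrightarrow> i \<le> j \<Longrightarrow> ?f (?\<sigma> i) \<ge> ?f (?\<sigma> j)"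
    using someI_ex[OF sorting_perm_exists[of N ?f]] unfolding best_perm_def by blast+
  define c where "c = ?f (?\<sigma> T)"
  define B where "B = ?\<sigma> ` {1..T}"
  have inj: "inj_on ?\<sigma> {1..T}"
    using permutes_inj_on[OF perm] by blast
  have fin: "finite S" "finite B" and cB: "card B = T"
    using finite_subset[OF S(1)] card_image[OF inj] by (auto simp: B_def)
  have hi: "c \<le> ?f i" if "i \<in> B" for i
    using that sorted TN False by (auto simp: B_def c_def)
  have lo: "?f i \<le> c" if "i \<in> {1..N} - B" for i
  proof -
    from that obtain j where j: "j \<in> {1..N}" "i = ?\<sigma> j"
      using permutes_image[OF perm] by blast
    with that have "T < j" by (force simp: B_def)
    then show ?thesis using j sorted[of T j] False TN by (simp add: c_def)
  qed
  have "card (S - B) = card (B - S)"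
  proof -
    have "card (S - B) + card (S \<inter> B) = card (B - S) + card (S \<inter> B)"
      using card_Diff_subset_Int[of S B] card_Diff_subset_Int[of B S] fin S(2) cB
        card_mono[OF fin(1), of "S \<inter> B"] card_mono[OF fin(2), of "S \<inter> B"]
      by (simp add: Int_commute)
    then show ?thesis by simp
  qed
  have "sum ?f S = sum ?f (S \<inter> B) + sum ?f (S - B)"
    by (rule sum.Int_Diff[OF fin(1)])
  also have "sum ?f (S - B) \<le> real (card (S - B)) * c"
    by (rule sum_bounded_above) (use lo S(1) in auto)
  also have "real (card (S - B)) * c = real (card (B - S)) * c"
    using \<open>card (S - B) = card (B - S)\<close> by simp
  also have "\<dots> \<le> sum ?f (B - S)"
    by (rule sum_bounded_below) (use hi in auto)
  also have "sum ?f (S \<inter> B) + sum ?f (B - S) = sum ?f B"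
    using sum.Int_Diff[OF fin(2), of ?f S] by (simp add: Int_commute)
  also have "sum ?f B = (\<Sum>t=1..T. ?f (?\<sigma> t))"
    unfolding B_def by (subst sum.reindex[OF inj]) simp
  finally show ?thesis by simp
qed

lemma play_support:
  assumes \<phi>: "\<phi> \<in> strategies N T" and "t \<le> T" "h \<in> set_pmf (play \<phi> y t)"
  shows "length h = t \<and> distinct (map fst h) \<and> fst ` set h \<subseteq> {1..N}"
  using assms(2,3)
proof (induction t arbitrary: h)
  case (Suc t)
  then obtain g i where g: "g \<in> set_pmf (play \<phi> y t)" and i: "i \<in> set_pmf (\<phi> g)"
    and h: "h = g @ [(i, y i)]" by auto
  have IH: "length g = t \<and> distinct (map fst g) \<and> fst ` set g \<subseteq> {1..N}"
    using Suc.IH[OF _ g] Suc.prems by simp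
  then have "i \<in> {1..N} - fst ` set g"
    using \<phi> i Suc.prems unfolding strategies_def by force
  then show ?case using IH h by auto
qed simp

text \<open>Centring by \<open>c\<close> is free because \<open>S\<close> and the set of pulled arms
  both have \<open>T\<close> elements. With \<open>c = 1/2\<close> the summands have known
  signs.\<close>

lemma regret_ge:
  assumes h: "length h = T" "distinct (map fst h)" and S: "S \<subseteq> {1..N}" "card S = T"
  shows "regret a m N T h \<ge> (\<Sum>i\<in>S. m (a i) - c) - (\<Sum>i\<in>fst ` set h. m (a i) - c)"
proof -
  let ?f = "\<lambda>i. m (a i)"
  have "(\<Sum>t=1..T. ?f (fst (h ! (t - 1)))) = (\<Sum>t<T. ?f (fst (h ! t)))"
    by (rule sum.reindex_bij_witness[of _ Suc "\<lambda>t. t - 1"]) auto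
  also have "\<dots> = (\<Sum>t<T. ?f (map fst h ! t))"
    using h(1) by (intro sum.cong) auto
  also have "\<dots> = sum ?f (set (map fst h))"
    by (rule sum.reindex_bij_betw, rule bij_betw_nth) (use h in auto)
  finally have "(\<Sum>t=1..T. ?f (fst (h ! (t - 1)))) = sum ?f (fst ` set h)"
    by simp
  moreover have "card (fst ` set h) = T"
    using h distinct_card[of "map fst h"] by simp
  ultimately show ?thesis
    using sum_best_perm_ge[OF S, of m a] S(2) by (simp add: regret_def sum_subtractf)
qed

section \<open>The two means on the grid of arms\<close>

text \<open>Passing from \<open>q\<close> to \<open>q + 1\<close> adds a zero at each end and raises
  each of the \<open>2 * q + 1\<close> old terms by 1.\<close>

lemma sum_tent: "(\<Sum>j\<le>2 * q. real (min j (2 * q - j))) = (real q)\<^sup>2"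
proof (induction q)
  case (Suc q)
  have "(\<Sum>j\<le>2 * Suc q. real (min j (2 * Suc q - j)))
      = (\<Sum>j\<le>Suc (2 * q). real (min (Suc j) (2 * Suc q - Suc j)))"
    by (simp del: sum.atMost_Suc add: sum.atMost_Suc_shift)
  also have "\<dots> = (\<Sum>j\<le>2 * q. real (min (Suc j) (2 * Suc q - Suc j)))"
    by simp
  also have "\<dots> = (\<Sum>j\<le>2 * q. real (min j (2 * q - j)) + 1)"
    by (intro sum.cong) (auto simp: min_def)
  also have "\<dots> = (real q)\<^sup>2 + (2 * real q + 1)"
    using Suc by (simp add: sum.distrib)
  finally show ?case by (simp add: power2_eq_square algebra_simps)
qed simp

context
  fixes K :: real and N T q :: nat
  assumes K: "0 < K" and q: "2 * q \<le> T" "T + 2 * q \<le> N" "0 < q"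
begin

text \<open>The nodes sit at the arms \<open>T - 2*q\<close>, \<open>T\<close> and
  \<open>T + 2*q\<close>. The even width puts the peaks at arms too, so the sum over a bump is an
  exact square.\<close>

abbreviation mean_at :: "real \<Rightarrow> nat \<Rightarrow> real" where
  "mean_at s i \<equiv> bump_mean K s (real T / real N) (2 * real q / real N) (real i / real N)"

lemma mean_at_eq:
  "mean_at s i - 1/2 =
    K * ((if i < T - 2*q then 1 else if i < T then s else if i < T + 2*q then - s else -1) *
      min \<bar>real i - real (T - 2*q)\<bar> (min \<bar>real i - real T\<bar> \<bar>real i - real (T + 2*q)\<bar>)) / real N"
proof -
  have N: "real N > 0" using q by simp
  have d: "\<bar>real i / real N - z / real N\<bar> = \<bar>real i - z\<bar> / real N" for z
    using N by (simp add: diff_divide_distrib[symmetric])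
  have z: "real T / real N - 2 * real q / real N = real (T - 2*q) / real N"
    "real T / real N + 2 * real q / real N = real (T + 2*q) / real N"
    using q by (simp_all add: diff_divide_distrib[symmetric] add_divide_distrib[symmetric] of_nat_diff)
  have mn: "min (u / real N) (v / real N) = min u v / real N" for u v
    using N by (simp add: min_def divide_le_cancel)
  have lt: "real i / real N < real j / real N \<longleftrightarrow> i < j" for j
    using N by (simp add: divide_less_cancel)
  show ?thesis
    unfolding bump_mean_def bump_sign_def node_dist_def z d mn lt by simp
qed

text \<open>Both endpoints are included: the tent vanishes there, so the sign at a node does not
  affect the formula.\<close>

lemma mean_at_left:
  assumes "j \<le> 2 * q"
  shows "mean_at s (T - 2*q + j) - 1/2 = K * s * real (min j (2 * q - j)) / real N"
proof -
  have "min \<bar>real (T - 2*q + j) - real (T - 2*q)\<bar>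
      (min \<bar>real (T - 2*q + j) - real T\<bar> \<bar>real (T - 2*q + j) - real (T + 2*q)\<bar>)
    = real (min j (2 * q - j))"
    using assms q by (auto simp: min_def)
  then show ?thesis
    unfolding mean_at_eq using assms q by auto
qed

lemma mean_at_right:
  assumes "j \<le> 2 * q"
  shows "mean_at s (T + j) - 1/2 = - K * s * real (min j (2 * q - j)) / real N"
proof -
  have "min \<bar>real (T + j) - real (T - 2*q)\<bar>
      (min \<bar>real (T + j) - real T\<bar> \<bar>real (T + j) - real (T + 2*q)\<bar>)
    = real (min j (2 * q - j))"
    using assms q by (auto simp: min_def)
  then show ?thesis
    unfolding mean_at_eq using assms q by auto
qed

lemma mean_at_below:
  assumes "i \<le> T - 2*q"
  shows "mean_at s i = mean_at 1 i" "mean_at s i \<ge> 1/2"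
proof -
  have "mean_at s i - 1/2 = mean_at 1 i - 1/2" "mean_at s i - 1/2 \<ge> 0"
    unfolding mean_at_eq using assms q K by auto
  then show "mean_at s i = mean_at 1 i" "mean_at s i \<ge> 1/2" by simp_all
qed

lemma mean_at_above:
  assumes "T + 2*q \<le> i"
  shows "mean_at s i = mean_at 1 i" "mean_at s i \<le> 1/2"
proof -
  have "mean_at s i - 1/2 = mean_at 1 i - 1/2" "mean_at s i - 1/2 \<le> 0"
    unfolding mean_at_eq using assms q K
    by (auto intro!: divide_nonpos_nonneg mult_nonneg_nonpos)
  then show "mean_at s i = mean_at 1 i" "mean_at s i \<le> 1/2" by simp_all
qed

lemma mean_at_between:
  assumes "T - 2*q < i" "i \<le> T + 2*q"
  shows "mean_at (-1) i = 1 - mean_at 1 i" "\<bar>mean_at 1 i - 1/2\<bar> \<le> K * real q / real N"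
proof -
  \<comment> \<open>Here \<open>s\<close> records the side of \<open>T\<close> (1 left, -1 right)
    and \<open>s'\<close> the hypothesis; the centred mean is odd in \<open>s'\<close>.\<close>
  obtain j s where j: "j \<le> 2 * q" and
    eq: "\<And>s'. mean_at s' i - 1/2 = s * s' * (K * real (min j (2 * q - j)) / real N)" and s: "\<bar>s\<bar> = (1::real)"
  proof (cases "i \<le> T")
    case True
    with assms have "i = T - 2*q + (i - (T - 2*q))" "i - (T - 2*q) \<le> 2*q" by auto
    then show ?thesis using mean_at_left[of "i - (T - 2*q)"] that[of "i - (T - 2*q)" 1] by simp
  next
    case False
    with assms have "i = T + (i - T)" "i - T \<le> 2*q" by auto
    then show ?thesis using mean_at_right[of "i - T"] that[of "i - T" "-1"] by simp
  qed
  show "mean_at (-1) i = 1 - mean_at 1 i"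
    using eq[of 1] eq[of "-1"] by simp
  have "K * real (min j (2 * q - j)) / real N \<le> K * real q / real N"
    using K by (intro divide_right_mono mult_left_mono) auto
  then show "\<bar>mean_at 1 i - 1/2\<bar> \<le> K * real q / real N"
    using K s unfolding eq by (simp add: abs_mult)
qed

lemma sum_block:
  assumes "\<And>j. j \<le> 2 * q \<Longrightarrow> f (b + j) = K * real (min j (2 * q - j)) / real N"
  shows "sum f {b<..b + 2*q} = K * (real q)\<^sup>2 / real N"
proof -
  have "sum f {b<..b + 2*q} = (\<Sum>j\<in>{0<..2*q}. f (b + j))"
    by (rule sum.reindex_bij_witness[of _ "\<lambda>j. b + j" "\<lambda>i. i - b"]) auto
  \<comment> \<open>The added term \<open>j = 0\<close> vanishes, which completes the half-open
    block to a full tent.\<close>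
  also have "\<dots> = (\<Sum>j\<le>2*q. f (b + j))"
    using assms[of 0] by (intro sum.mono_neutral_left) auto
  also have "\<dots> = (\<Sum>j\<le>2*q. K / real N * real (min j (2 * q - j)))"
    using assms by (intro sum.cong) auto
  also have "\<dots> = K * (real q)\<^sup>2 / real N"
    by (simp only: sum_distrib_left[symmetric] sum_tent) simp
  finally show ?thesis .
qed

text \<open>The competitors are \<open>?J\<close> with the left bump for \<open>s = 1\<close> and
  \<open>?J\<close> with the right bump for \<open>s = -1\<close>. Each gains one bump over
  \<open>?J\<close>, whereas no set of pulled arms beats \<open>?J\<close> for the sum of the two
  centred means.\<close>

lemma regret_sum_ge:
  assumes h: "length h = T" "distinct (map fst h)" "fst ` set h \<subseteq> {1..N}"
  defines "R \<equiv> \<lambda>s. regret (\<lambda>i. real i / real N)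
    (bump_mean K s (real T / real N) (2 * real q / real N)) N T h"
  shows "2 * (K * (real q)\<^sup>2 / real N) \<le> R 1 + R (-1)"
proof -
  let ?g = "\<lambda>s i. mean_at s i - 1/2" and ?J = "{1..T - 2*q}" and ?H = "fst ` set h"
  let ?A = "{T - 2*q<..T}" and ?B = "{T<..T + 2*q}"
  have A: "sum (?g 1) ?A = K * (real q)\<^sup>2 / real N"
    using sum_block[of "?g 1" "T - 2*q"] mean_at_left[of _ 1] q by simp
  have B: "sum (?g (-1)) ?B = K * (real q)\<^sup>2 / real N"
    using sum_block[of "?g (-1)" T] mean_at_right[of _ "-1"] q by simp
  have sizes: "?J \<union> ?A \<subseteq> {1..N}" "card (?J \<union> ?A) = T"
    "?J \<union> ?B \<subseteq> {1..N}" "card (?J \<union> ?B) = T"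
  proof -
    have "card (?J \<union> ?A) = card ?J + card ?A" "card (?J \<union> ?B) = card ?J + card ?B"
      by (rule card_Un_disjoint; auto)+
    then show "card (?J \<union> ?A) = T" "card (?J \<union> ?B) = T"
      using q by simp_all
  qed (use q in auto)
  have R1: "sum (?g 1) (?J \<union> ?A) - sum (?g 1) ?H \<le> R 1"
    unfolding R_def
    by (rule regret_ge[OF h(1,2) sizes(1,2)])
  have R2: "sum (?g (-1)) (?J \<union> ?B) - sum (?g (-1)) ?H \<le> R (-1)"
    unfolding R_def
    by (rule regret_ge[OF h(1,2) sizes(3,4)])
  have S1: "sum (?g 1) (?J \<union> ?A) = sum (?g 1) ?J + K * (real q)\<^sup>2 / real N"
    unfolding A[symmetric] by (rule sum.union_disjoint) auto
  have S2: "sum (?g (-1)) (?J \<union> ?B) = sum (?g (-1)) ?J + K * (real q)\<^sup>2 / real N"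
    unfolding B[symmetric] by (rule sum.union_disjoint) auto
  have H: "sum (?g 1) ?H + sum (?g (-1)) ?H \<le> sum (?g 1) ?J + sum (?g (-1)) ?J"
  proof -
    \<comment> \<open>The two centred means cancel on the bumps and agree elsewhere.\<close>
    let ?G = "\<lambda>i. ?g 1 i + ?g (-1) i"
    have pos: "0 \<le> ?G i" if "i \<in> ?J" for i
      using mean_at_below(2)[of i 1] mean_at_below(2)[of i "-1"] that by simp
    have neg: "?G i \<le> 0" if "i \<in> ?H - ?J" for i
    proof (cases "i \<le> T + 2*q")
      case True
      then show ?thesis using mean_at_between(1)[of i] that h(3) by force
    next
      case False
      then show ?thesis using mean_at_above(2)[of i 1] mean_at_above(2)[of i "-1"] by simp
    qed
    have "sum ?G ?H = sum ?G (?H \<inter> ?J) + sum ?G (?H - ?J)"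
      by (rule sum.Int_Diff) simp
    also have "\<dots> \<le> sum ?G ?J + 0"
      by (intro add_mono sum_mono2 sum_nonpos) (use pos neg in auto)
    finally show ?thesis by (simp only: sum.distrib add_0_right)
  qed
  \<comment> \<open>Adding the two bounds, the sums over the pulled arms are absorbed by those over
    \<open>?J\<close>, and one bump \<open>u\<close> per hypothesis remains.\<close>
  have "a - c \<le> r \<Longrightarrow> b - d \<le> r' \<Longrightarrow> a = e + u \<Longrightarrow> b = f + u \<Longrightarrow> c + d \<le> e + f \<Longrightarrow> 2 * u \<le> r + r'"
    for a b c d e f u r r' :: real by linarith
  from this[OF R1 R2 S1 S2 H] show ?thesis .
qed

text \<open>By \<open>regret_sum_ge\<close> every history has regret at least \<open>r\<close> under
  one of the two means, so the two events cover all plays and the testing bound applies.\<close>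

lemma exists_bad_mean:
  assumes \<phi>: "\<phi> \<in> strategies N T"
    and K': "K \<le> 1/2" and noise: "K\<^sup>2 * real q ^ 3 \<le> 0.027 * (real N)\<^sup>2"
    and r: "r \<le> K * (real q)\<^sup>2 / real N"
  shows "\<exists>s. \<bar>s\<bar> = 1 \<and> measure (history_pmf (\<lambda>i. real i / real N)
    (bump_mean K s (real T / real N) (2 * real q / real N)) N T \<phi>)
    {h. regret (\<lambda>i. real i / real N)
      (bump_mean K s (real T / real N) (2 * real q / real N)) N T h \<ge> r} \<ge> 0.1"
proof -
  let ?m = "\<lambda>s. bump_mean K s (real T / real N) (2 * real q / real N)"
  let ?E = "\<lambda>s. {h. regret (\<lambda>i. real i / real N) (?m s) N T h \<ge> r}"
  let ?P = "\<lambda>s i. bernoulli_pmf (mean_at s i)"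
  let ?pr = "\<lambda>s. measure (history_pmf (\<lambda>i. real i / real N) (?m s) N T \<phi>) (?E s)"
  let ?S = "PiE_dflt {1..N} False (\<lambda>_. UNIV :: bool set)"
  let ?B = "{T - 2*q<..T + 2*q}"
  have N: "real N > 0" using q by simp
  have supp: "set_pmf (play \<phi> y T) \<subseteq> ?E 1 \<union> ?E (-1)" for y
  proof
    fix h assume "h \<in> set_pmf (play \<phi> y T)"
    then have "length h = T" "distinct (map fst h)"
      "fst ` set h \<subseteq> {1..N}"
      using play_support[OF \<phi> order_refl] by blast+
    from regret_sum_ge[OF this] r show "h \<in> ?E 1 \<union> ?E (-1)" by auto
  qed
  have sub: "set_pmf (rewards_pmf (\<lambda>i. real i / real N) (?m s) N) \<subseteq> ?S" for s
    unfolding rewards_pmf_def by (subst set_Pi_pmf) (auto simp: PiE_dflt_def)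
  have "1 - 4 * real (card ?B) * (K * real q / real N)\<^sup>2
      \<le> (\<Prod>i\<in>{1..N}. \<Sum>b\<in>UNIV. sqrt (pmf (?P 1 i) b * pmf (?P (-1) i) b))\<^sup>2"
  proof (rule affinity_bernoulli_ge)
    show "?B \<subseteq> {1..N}" using q by auto
    show "mean_at 1 i \<in> {0..1}" if "i \<in> {1..N}" for i
      using that q N K K' by (intro bump_mean_range) auto
    show "mean_at (-1) i = mean_at 1 i" if "i \<in> {1..N} - ?B" for i
      using that mean_at_below(1)[of i "-1"] mean_at_above(1)[of i "-1"] by fastforce
  qed (use mean_at_between in auto)
  also have "\<dots> = (\<Sum>y\<in>?S. sqrt (pmf (rewards_pmf (\<lambda>i. real i / real N) (?m 1) N) y *
      pmf (rewards_pmf (\<lambda>i. real i / real N) (?m (-1)) N) y))\<^sup>2"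
    unfolding rewards_pmf_def by (subst affinity_Pi_pmf) auto
  also have "\<dots> / 2 \<le> ?pr 1 + ?pr (-1)"
    unfolding history_pmf_def
    by (rule two_point_testing_bound[OF _ sub sub supp]) auto
  finally have lower: "(1 - 4 * real (card ?B) * (K * real q / real N)\<^sup>2) / 2 \<le> ?pr 1 + ?pr (-1)"
    by simp
  \<comment> \<open>The two bumps hold \<open>4 * q\<close> arms. The squared affinity is at least
    \<open>1 - 0.432\<close>; half of it is 0.284, above the 0.2 to be shared by two events.\<close>
  have "4 * real (card ?B) * (K * real q / real N)\<^sup>2 = 16 * (K\<^sup>2 * real q ^ 3) / (real N)\<^sup>2"
    using q by (simp add: power2_eq_square power3_eq_cube)
  also have "\<dots> \<le> 16 * (0.027 * (real N)\<^sup>2) / (real N)\<^sup>2"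
    using noise by (intro divide_right_mono mult_left_mono) auto
  also have "\<dots> = 0.432" using N by simp
  finally have "0.2 \<le> ?pr 1 + ?pr (-1)" using lower by simp
  then have "0.1 \<le> ?pr 1 \<or> 0.1 \<le> ?pr (-1)" by linarith
  then show ?thesis
    by (metis abs_minus_cancel abs_one)
qed

end

section \<open>Choice of the bump width and conclusion\<close>

lemma exists_nat_half_between:
  fixes x :: real
  assumes "1 \<le> x"
  obtains q :: nat where "0 < q" "real q \<le> x" "x \<le> 2 * real q"
proof
  \<comment> \<open>As the floor is at least 1, \<open>x\<close> lies below the floor plus 1, hence
    below twice the floor.\<close>
  have "1 \<le> \<lfloor>x\<rfloor>" using assms by (simp add: le_floor_iff)
  then have "real (nat \<lfloor>x\<rfloor>) = of_int \<lfloor>x\<rfloor>" "(1::real) \<le> of_int \<lfloor>x\<rfloor>" by simp_all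
  then show "0 < nat \<lfloor>x\<rfloor>" "real (nat \<lfloor>x\<rfloor>) \<le> x" "x \<le> 2 * real (nat \<lfloor>x\<rfloor>)"
    using \<open>1 \<le> \<lfloor>x\<rfloor>\<close> floor_correct[of x] by linarith+
qed

theorem theorem2:
  fixes L :: real
  assumes "L > 0"
  shows "\<exists>C::real. \<forall>p Q :: real. \<forall>N T :: nat.
    0 < p \<longrightarrow> p < 1 \<longrightarrow> Q > max (6 / L) 12 \<longrightarrow>
    real N \<ge> C * max (p powi (-3)) ((1 - p) powi (-3)) \<longrightarrow>
    real T = p * real N \<longrightarrow>
    (let a = (\<lambda>i. real i / real N) in
      (INF \<phi>\<in>strategies N T. SUP m\<in>reward_class p L Q.
        emeasure (measure_pmf (history_pmf a m N T \<phi>))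
          {h. regret a m N T h \<ge> 0.01 * real T powr (1 / 3) * p powr (- 1 / 3)})
      \<ge> ennreal 0.1)"
proof -
  \<comment> \<open>The cap \<open>L\<close> serves condition (i), the cap 1/2 the range;
    \<open>6 / K\<close> is then exactly \<open>max (6 / L) 12\<close>. In \<open>C\<close>, the
    entry \<open>1 / K^2\<close> makes the bumps fit on both sides of \<open>p\<close>, and 10 makes
    the real target \<open>x\<close> for \<open>q\<close> at least 1.\<close>
  define K where "K = min L (1/2)"
  define C where "C = max (1 / K\<^sup>2) 10"
  have K: "0 < K" "K \<le> L" "K \<le> 1/2" using assms by (auto simp: K_def)
  show ?thesis
    unfolding Let_def
  proof (intro exI[of _ C] allI impI INF_greatest)
    fix p Q :: real and N T :: nat and \<phi>
    assume p: "0 < p" "p < 1" and Q: "Q > max (6 / L) 12"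
      and NC: "real N \<ge> C * max (p powi (-3)) ((1 - p) powi (-3))"
      and T: "real T = p * real N" and \<phi>: "\<phi> \<in> strategies N T"
    have Np: "1 \<le> K\<^sup>2 * real N * u ^ 3 \<and> 10 \<le> real N * u ^ 3" if u: "u = p \<or> u = 1 - p" for u
    proof -
      have "0 < u" using u p by auto
      have "u powi (-3) = 1 / u ^ 3"
        by (simp add: power_int_minus_divide)
      then have "C * (1 / u ^ 3) \<le> C * max (p powi (-3)) ((1 - p) powi (-3))"
        using u by (intro mult_left_mono) (auto simp: C_def)
      also note NC
      finally have "C \<le> real N * u ^ 3"
        using \<open>0 < u\<close> by (simp add: pos_divide_le_eq)
      then have "1 / K\<^sup>2 \<le> real N * u ^ 3" "10 \<le> real N * u ^ 3"
        by (auto simp: C_def)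
      then show ?thesis using K by (simp add: field_simps)
    qed
    have N10: "10 \<le> real N"
    proof -
      have "real N * p ^ 3 \<le> real N * 1"
        using p by (intro mult_left_mono power_le_one) auto
      then show ?thesis using Np[of p] by simp
    qed
    then have N: "0 < real N" by simp
    \<comment> \<open>The largest real bump parameter that the noise condition of
      \<open>exists_bad_mean\<close> permits; rounding to \<open>q\<close> loses at most a factor
      2.\<close>
    define x where "x = root 3 (0.027 * (real N)\<^sup>2 / K\<^sup>2)"
    have x3: "K\<^sup>2 * x ^ 3 = 0.027 * (real N)\<^sup>2"
      using K by (simp add: x_def)
    have "1 \<le> x"
    proof -
      have "1 \<le> 0.027 * (10::real)\<^sup>2 / (1/2)\<^sup>2" by (simp add: power2_eq_square)
      also have "\<dots> \<le> 0.027 * (real N)\<^sup>2 / K\<^sup>2"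
        using N10 K by (intro frac_le mult_left_mono power_mono) auto
      finally show ?thesis by (simp add: x_def)
    qed
    then obtain q :: nat where q: "0 < q" "real q \<le> x" "x \<le> 2 * real q"
      by (rule exists_nat_half_between)
    have upper: "K\<^sup>2 * real q ^ 3 \<le> 0.027 * (real N)\<^sup>2"
      unfolding x3[symmetric] using q by (intro mult_left_mono power_mono) auto
    have lower: "0.027 * (real N)\<^sup>2 \<le> 8 * K\<^sup>2 * real q ^ 3"
    proof -
      have "K\<^sup>2 * x ^ 3 \<le> K\<^sup>2 * (2 * real q) ^ 3"
        using q \<open>1 \<le> x\<close> by (intro mult_left_mono power_mono) auto
      then show ?thesis unfolding x3 by (simp add: power_mult_distrib)
    qed
    have width: "2 * real q \<le> u * real N" if u: "u = p \<or> u = 1 - p" for u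
    proof (rule power_le_imp_le_base[of _ 2])
      \<comment> \<open>Widths are compared through their cubes; \<open>8 * 0.027 = 0.216\<close> is
        below 1, and the factor from \<open>Np\<close> is at least 1.\<close>
      have "K\<^sup>2 * (2 * real q) ^ 3 \<le> 8 * (0.027 * (real N)\<^sup>2)"
        using upper by (simp add: power_mult_distrib)
      also have "\<dots> \<le> (real N)\<^sup>2 * 1" by simp
      also have "\<dots> \<le> (real N)\<^sup>2 * (K\<^sup>2 * real N * u ^ 3)"
        using Np[OF u] by (intro mult_left_mono) auto
      also have "\<dots> = K\<^sup>2 * (u * real N) ^ 3"
        by (simp add: power_mult_distrib power2_eq_square power3_eq_cube)
      finally show "(2 * real q) ^ Suc 2 \<le> (u * real N) ^ Suc 2"
        using K by simp
      show "0 \<le> u * real N" using u p by auto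
    qed
    have qT: "2 * q \<le> T" "T + 2 * q \<le> N"
      using width[of p] width[of "1 - p"] T by (simp_all add: left_diff_distrib)
    have pT: "p = real T / real N" using T N by simp
    let ?r = "0.01 * real T powr (1 / 3) * p powr (- 1 / 3)"
    \<comment> \<open>Since \<open>T = p * N\<close>, the powers of \<open>p\<close> cancel.\<close>
    have r_eq: "?r = 0.01 * real N powr (1 / 3)"
      using p N by (simp add: T powr_mult powr_minus field_simps)
    have r: "?r \<le> K * (real q)\<^sup>2 / real N"
    proof (rule power_le_imp_le_base[of _ 2])
      \<comment> \<open>After cubing and multiplying by \<open>K * N^3\<close>, the right side
        becomes \<open>(K^2 * q^3)^2\<close>, which \<open>lower\<close> controls. The numerical
        requirement is that half of \<open>0.01^3\<close> be at most
        \<open>(0.027 / 8)^2\<close>.\<close>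
      have "(real N powr (1 / 3)) ^ 3 = real N"
        using N by (simp add: powr_power)
      then have "?r ^ Suc 2 * (K * real N ^ 3) = 0.000001 * (K * real N ^ 4)"
        unfolding r_eq by (simp add: power_mult_distrib power_divide power4_eq_xxxx power3_eq_cube)
      also have "\<dots> \<le> 0.000001 * (1/2 * real N ^ 4)"
        using K by (intro mult_left_mono mult_right_mono) auto
      also have "\<dots> \<le> (0.027 * (real N)\<^sup>2 / 8)\<^sup>2"
        by (simp add: power2_eq_square power4_eq_xxxx)
      also have "\<dots> \<le> (K\<^sup>2 * real q ^ 3)\<^sup>2"
        using lower by (intro power_mono) auto
      also have "\<dots> = (K * (real q)\<^sup>2 / real N) ^ Suc 2 * (K * real N ^ 3)"
        using N by (simp add: power_mult_distrib power_divide power2_eq_square power3_eq_cube)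
      finally show "?r ^ Suc 2 \<le> (K * (real q)\<^sup>2 / real N) ^ Suc 2"
        using K N by (simp add: mult_le_cancel_right)
      show "0 \<le> K * (real q)\<^sup>2 / real N" using K by simp
    qed
    obtain s where s: "\<bar>s\<bar> = 1" and bad: "measure (history_pmf (\<lambda>i. real i / real N)
        (bump_mean K s p (2 * real q / real N)) N T \<phi>)
        {h. regret (\<lambda>i. real i / real N)
          (bump_mean K s p (2 * real q / real N)) N T h \<ge> ?r} \<ge> 0.1"
      using exists_bad_mean[OF K(1) qT q(1) \<phi> K(3) upper r] unfolding pT[symmetric] by blast
    have "6 / K \<le> Q"
      using Q by (auto simp: K_def min_def)
    moreover have "2 * real q / real N \<le> p" "p + 2 * real q / real N \<le> 1"
      using width[of p] width[of "1 - p"] N by (simp_all add: field_simps)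
    ultimately have "bump_mean K s p (2 * real q / real N) \<in> reward_class p L Q"
      using s K N q by (intro bump_mean_in_reward_class) auto
    then show "ennreal 0.1 \<le> (SUP m\<in>reward_class p L Q.
        emeasure (measure_pmf (history_pmf (\<lambda>i. real i / real N) m N T \<phi>))
          {h. regret (\<lambda>i. real i / real N) m N T h \<ge> ?r})"
      by (rule SUP_upper2) (use bad in \<open>simp add: measure_pmf.emeasure_eq_measure ennreal_leI\<close>)
  qed
qed

end
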